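(* Let $\mathbb{K}$ be an algebraically closed field and let $G$ be a forest on the vertex set $[n]$. Then $$\mathrm{v}_{\mathfrak{p}_{\emptyset}(G)}(L_G^{\mathbb{K}}(2))=v_2(G)=|\mathrm{iv}(G)|,$$ where $v_2(G)$ is the number of vertices of $G$ of degree at least $2$ and $\mathrm{iv}(G)$ is the set of vertices of $G$ which are neither leaves nor isolated.
   Context: $[n]=\{1,\dots,n\}$ and $R=\mathbb{K}[x_{i,j}: i\in[n], j\in\{1,2\}]$ with the standard grading. The Lovász–Saks–Schrijver ideal of $G$ in dimension $2$ is $$L_G^{\mathbb{K}}(2)=\big(x_{i,1}x_{j,1}+x_{i,2}x_{j,2} : \{i,j\}\in E(G)\big)\subset R .$$ Let $U_G=\{(v_1,\dots,v_n)\in(\mathbb{K}^2)^n: v_i\cdot v_j=0 \text{ for all } \{i,j\}\in E(G),\ v_i\neq 0\text{ for all } i\in[n]\}$, where $v\cdot w=v_1w_1+v_2w_2$, and let $\mathfrak{p}_{\emptyset}(G)\subset R$ be the ideal of all polynomials vanishing on $U_G$; it is a minimal prime of $L_G^{\mathbb{K}}(2)$. For a graded ideal $I\subset R$ and $\mathfrak p\in\mathrm{Ass}(I)$, $\mathrm{v}_{\mathfrak p}(I)=\min\{e\ge 0:\exists f\in R_e \text{ with } I:f=\mathfrak p\}$. *)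

theory Defs
  imports
    "HOL-Analysis.Finite_Cartesian_Product"
    "HOL-Computational_Algebra.Polynomial"
    "HOL-Library.Poly_Mapping"
    "HOL-Library.Extended_Nat"
begin

section \<open>Graphs and forests\<close>

text \<open>
  The vertex set \<open>[n]\<close> is the universe of a finite type \<open>'n\<close>, with \<open>n = CARD('n)\<close>.
  A graph is given by its edge set.
\<close>

definition simple_graph :: "'n set set \<Rightarrow> bool" where
  "simple_graph E \<longleftrightarrow> (\<forall>e\<in>E. card e = 2)"

definition graph_cycle :: "'n set set \<Rightarrow> 'n list \<Rightarrow> bool" where
  "graph_cycle E vs \<longleftrightarrow>
     length vs \<ge> 3 \<and> distinct vs \<and>
     (\<forall>i<length vs. {vs ! i, vs ! (Suc i mod length vs)} \<in> E)"

definition forest_graph :: "'n set set \<Rightarrow> bool" where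
  "forest_graph E \<longleftrightarrow> simple_graph E \<and> (\<nexists>vs. graph_cycle E vs)"

definition vertex_degree :: "'n::finite set set \<Rightarrow> 'n \<Rightarrow> nat" where
  "vertex_degree E v = card {e \<in> E. v \<in> e}"

definition leaf :: "'n::finite set set \<Rightarrow> 'n \<Rightarrow> bool" where
  "leaf E v \<longleftrightarrow> vertex_degree E v = 1"

definition isolated_vertex :: "'n::finite set set \<Rightarrow> 'n \<Rightarrow> bool" where
  "isolated_vertex E v \<longleftrightarrow> vertex_degree E v = 0"

definition iv :: "'n::finite set set \<Rightarrow> 'n set" where
  "iv E = {v. \<not> leaf E v \<and> \<not> isolated_vertex E v}"

definition v2 :: "'n::finite set set \<Rightarrow> nat" where
  "v2 E = card {v. vertex_degree E v \<ge> 2}"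


section \<open>The polynomial ring\<close>

text \<open>
  A monomial is a finitely supported exponent vector and a polynomial is a finitely supported
  function from monomials to coefficients; multiplication is convolution.
\<close>

type_synonym ('x, 'k) mpoly = "('x \<Rightarrow>\<^sub>0 nat) \<Rightarrow>\<^sub>0 'k"

text \<open>
  The ring \<open>R = K[x_{i,j}]\<close>. The second index lives in the two-element type \<open>2\<close>,
  whose elements are \<open>1\<close> and \<open>2\<close> (with \<open>2 = 0\<close> in that type).
\<close>

type_synonym ('n, 'k) lss_ring = "('n \<times> 2, 'k) mpoly"

definition Var :: "'x \<Rightarrow> ('x, 'k::field) mpoly" where
  "Var x = Poly_Mapping.single (Poly_Mapping.single x 1) 1"

definition monom_degree :: "('x \<Rightarrow>\<^sub>0 nat) \<Rightarrow> nat" where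
  "monom_degree m = (\<Sum>x\<in>Poly_Mapping.keys m. Poly_Mapping.lookup m x)"

definition homogeneous_component :: "nat \<Rightarrow> ('x, 'k::field) mpoly set" where
  "homogeneous_component e = {p. \<forall>m\<in>Poly_Mapping.keys p. monom_degree m = e}"

definition eval_mpoly :: "('x \<Rightarrow> 'k) \<Rightarrow> ('x, 'k::field) mpoly \<Rightarrow> 'k" where
  "eval_mpoly a p = (\<Sum>m\<in>Poly_Mapping.keys p. Poly_Mapping.lookup p m * (\<Prod>x\<in>Poly_Mapping.keys m. a x ^ Poly_Mapping.lookup m x))"


section \<open>Ideals and v-numbers\<close>

text \<open>The ideal generated by a set is its span in the ring as a module over itself.\<close>

definition ideal_generated :: "'r::comm_ring_1 set \<Rightarrow> 'r set" where
  "ideal_generated S = module.span (*) S"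

definition ideal_colon :: "'r::comm_ring_1 set \<Rightarrow> 'r \<Rightarrow> 'r set" where
  "ideal_colon I f = {g. g * f \<in> I}"

text \<open>
  The minimum is taken in \<^typ>\<open>enat\<close>, where the infimum of the empty set is \<open>\<infinity>\<close>: a finite
  value is attained, so it asserts in particular that \<open>P = I : f\<close> for some homogeneous \<open>f\<close>.
\<close>

definition v_number :: "('x, 'k::field) mpoly set \<Rightarrow> ('x, 'k) mpoly set \<Rightarrow> enat" where
  "v_number P I = Inf (enat ` {e. \<exists>f\<in>homogeneous_component e. ideal_colon I f = P})"


section \<open>Lovasz-Saks-Schrijver ideals in dimension 2\<close>

definition LSS_ideal :: "'n set set \<Rightarrow> ('n, 'k::field) lss_ring set" where
  "LSS_ideal E =
     ideal_generated
       {Var (i, 1) * Var (j, 1) + Var (i, 2) * Var (j, 2) | i j. {i, j} \<in> E}"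

definition dot2 :: "'k::field ^ 2 \<Rightarrow> 'k ^ 2 \<Rightarrow> 'k" where
  "dot2 v w = v $ 1 * w $ 1 + v $ 2 * w $ 2"

definition U_set :: "'n::finite set set \<Rightarrow> ('k::field ^ 2 ^ 'n) set" where
  "U_set E = {v. (\<forall>i j. {i, j} \<in> E \<longrightarrow> dot2 (v $ i) (v $ j) = 0) \<and> (\<forall>i. v $ i \<noteq> 0)}"

definition p_empty :: "'n::finite set set \<Rightarrow> ('n, 'k::field) lss_ring set" where
  "p_empty E = {p. \<forall>v\<in>U_set E. eval_mpoly (\<lambda>(i, j). v $ i $ j) p = 0}"

end

theory Submission
  imports Defs "HOL-Analysis.Cartesian_Space"
begin

text \<open>
  A forest has a proper 2-colouring. Rotating the coordinates \<open>(x\<^sub>1, x\<^sub>2)\<close> to \<open>(x\<^sub>2, -x\<^sub>1)\<close> at the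
  vertices of one colour turns every edge generator into a 2-minor, up to sign, in any characteristic;
  \<open>U\<close> then consists of the families of nonzero vectors that are parallel along edges.

  Upper bound: let \<open>F\<close> be the product of the first coordinates of the vertices of degree at least 2.
  The exchange relation along a path shows that \<open>F\<close> multiplies the minor of any two connected
  vertices into the ideal, so modulo the ideal \<open>F\<close> times a monomial depends only on the degree
  at each vertex and the number of first coordinates in each component. Distinct such data give
  distinct characters on the torus points of \<open>U\<close>, so a polynomial that vanishes on \<open>U\<close> has
  coefficient sum zero on each class, and \<open>F\<close> multiplies it into the ideal.

  Lower bound: if \<open>I : f\<close> is the prime, then \<open>f\<close> is nonzero at some point of \<open>U\<close> but vanishes at every
  point obtained from it by zeroing a nonempty set of vertices of degree at least 2. By
  inclusion-exclusion some monomial of \<open>f\<close> involves all these vertices.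
\<close>

section \<open>Ideals, evaluation and characters\<close>

lemma module_ring: "module ((*) :: 'r::comm_ring_1 \<Rightarrow> 'r \<Rightarrow> 'r)"
  by unfold_locales (auto simp: algebra_simps)

lemma ideal_generated_base: "a \<in> S \<Longrightarrow> a \<in> ideal_generated S"
  unfolding ideal_generated_def by (rule module.span_base[OF module_ring])

lemma ideal_generated_zero: "0 \<in> ideal_generated S"
  unfolding ideal_generated_def by (rule module.span_zero[OF module_ring])

lemma ideal_generated_add:
  "a \<in> ideal_generated S \<Longrightarrow> b \<in> ideal_generated S \<Longrightarrow> a + b \<in> ideal_generated S"
  unfolding ideal_generated_def by (rule module.span_add[OF module_ring])

lemma ideal_generated_neg: "a \<in> ideal_generated S \<Longrightarrow> - a \<in> ideal_generated S"
  unfolding ideal_generated_def by (rule module.span_neg[OF module_ring])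

lemma ideal_generated_mult: "a \<in> ideal_generated S \<Longrightarrow> r * a \<in> ideal_generated S"
  unfolding ideal_generated_def by (rule module.span_scale[OF module_ring])

lemma ideal_generated_sum:
  "(\<And>x. x \<in> A \<Longrightarrow> f x \<in> ideal_generated S) \<Longrightarrow> sum f A \<in> ideal_generated S"
  unfolding ideal_generated_def by (rule module.span_sum[OF module_ring])

lemma ideal_generated_induct [consumes 1, case_names zero step]:
  assumes "a \<in> ideal_generated S"
    and "P 0"
    and "\<And>r x y. x \<in> S \<Longrightarrow> P y \<Longrightarrow> P (r * x + y)"
  shows "P a"
  using assms module.span_induct_alt[OF module_ring, of a S P]
  unfolding ideal_generated_def by blast

section \<open>Evaluation as a ring homomorphism\<close>

definition monom_eval :: "('x \<Rightarrow> 'k::field) \<Rightarrow> ('x \<Rightarrow>\<^sub>0 nat) \<Rightarrow> 'k" where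
  "monom_eval a m = (\<Prod>x\<in>Poly_Mapping.keys m. a x ^ Poly_Mapping.lookup m x)"

lemma monom_eval_UNIV:
  fixes a :: "'x::finite \<Rightarrow> 'k::field"
  shows "monom_eval a m = (\<Prod>x\<in>UNIV. a x ^ Poly_Mapping.lookup m x)"
  unfolding monom_eval_def by (rule prod.mono_neutral_left) (auto simp: in_keys_iff)

lemma monom_eval_add:
  fixes a :: "'x::finite \<Rightarrow> 'k::field"
  shows "monom_eval a (m + m') = monom_eval a m * monom_eval a m'"
  by (simp add: monom_eval_UNIV lookup_add power_add prod.distrib)

lemma eval_mpoly_alt:
  "eval_mpoly a p = (\<Sum>m\<in>Poly_Mapping.keys p. Poly_Mapping.lookup p m * monom_eval a m)"
  by (simp add: eval_mpoly_def monom_eval_def)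

lemma eval_mpoly_superset:
  assumes "finite A" "Poly_Mapping.keys p \<subseteq> A"
  shows "eval_mpoly a p = (\<Sum>m\<in>A. Poly_Mapping.lookup p m * monom_eval a m)"
  unfolding eval_mpoly_alt by (rule sum.mono_neutral_left) (use assms in \<open>auto simp: in_keys_iff\<close>)

lemma eval_mpoly_zero [simp]: "eval_mpoly a 0 = 0"
  by (simp add: eval_mpoly_def)

lemma eval_mpoly_add: "eval_mpoly a (p + q) = eval_mpoly a p + eval_mpoly a q"
proof -
  let ?A = "Poly_Mapping.keys p \<union> Poly_Mapping.keys q"
  have "eval_mpoly a (p + q) = (\<Sum>m\<in>?A. Poly_Mapping.lookup (p + q) m * monom_eval a m)"
    by (rule eval_mpoly_superset) (simp, rule Poly_Mapping.keys_add)
  also have "\<dots> = eval_mpoly a p + eval_mpoly a q"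
    using eval_mpoly_superset[of ?A p a] eval_mpoly_superset[of ?A q a]
    by (simp add: lookup_add distrib_right sum.distrib)
  finally show ?thesis .
qed

lemma eval_mpoly_sum: "eval_mpoly a (sum f A) = (\<Sum>x\<in>A. eval_mpoly a (f x))"
  by (induction A rule: infinite_finite_induct) (auto simp: eval_mpoly_add)

lemma eval_mpoly_single: "eval_mpoly a (Poly_Mapping.single m c) = c * monom_eval a m"
  by (cases "c = 0") (auto simp: eval_mpoly_alt)

lemma mpoly_sum_single:
  "p = (\<Sum>m\<in>Poly_Mapping.keys p. Poly_Mapping.single m (Poly_Mapping.lookup p m))"
proof (rule poly_mapping_eqI)
  fix k
  show "Poly_Mapping.lookup p k =
    Poly_Mapping.lookup (\<Sum>m\<in>Poly_Mapping.keys p. Poly_Mapping.single m (Poly_Mapping.lookup p m)) k"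
    by (simp add: lookup_sum lookup_single when_def in_keys_iff)
qed

lemma eval_mpoly_mult:
  fixes a :: "'x::finite \<Rightarrow> 'k::field"
  shows "eval_mpoly a (p * q) = eval_mpoly a p * eval_mpoly a q"
proof -
  let ?P = "Poly_Mapping.keys p" and ?Q = "Poly_Mapping.keys q"
  let ?l = Poly_Mapping.lookup
  have "p * q = (\<Sum>m\<in>?P. Poly_Mapping.single m (?l p m)) * (\<Sum>m\<in>?Q. Poly_Mapping.single m (?l q m))"
    using mpoly_sum_single[of p] mpoly_sum_single[of q] by simp
  also have "\<dots> = (\<Sum>m\<in>?P. \<Sum>m'\<in>?Q. Poly_Mapping.single (m + m') (?l p m * ?l q m'))"
    by (simp add: sum_product mult_single)
  finally have "eval_mpoly a (p * q) =
      (\<Sum>m\<in>?P. \<Sum>m'\<in>?Q. (?l p m * ?l q m') * (monom_eval a m * monom_eval a m'))"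
    by (simp add: eval_mpoly_sum eval_mpoly_single monom_eval_add)
  also have "\<dots> = eval_mpoly a p * eval_mpoly a q"
    by (simp add: eval_mpoly_alt sum_product mult_ac)
  finally show ?thesis .
qed

lemma eval_mpoly_Var [simp]: "eval_mpoly a (Var x) = a x"
  by (simp add: Var_def eval_mpoly_single monom_eval_def)

lemma eval_mpoly_one [simp]: "eval_mpoly a 1 = 1"
  using eval_mpoly_single[of a 0 1] by (simp add: monom_eval_def)

lemma eval_mpoly_uminus: "eval_mpoly a (- p) = - eval_mpoly a p"
  using eval_mpoly_add[of a p "- p"] by (simp add: eq_neg_iff_add_eq_0 add.commute)

lemma eval_mpoly_diff: "eval_mpoly a (p - q) = eval_mpoly a p - eval_mpoly a q"
  using eval_mpoly_add[of a p "- q"] by (simp add: eval_mpoly_uminus)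

lemma eval_mpoly_prod:
  fixes a :: "'x::finite \<Rightarrow> 'k::field"
  shows "eval_mpoly a (prod f A) = (\<Prod>x\<in>A. eval_mpoly a (f x))"
  by (induction A rule: infinite_finite_induct) (auto simp: eval_mpoly_mult)

section \<open>Monomials and the grading\<close>

lemma Var_power: "Var x ^ n = Poly_Mapping.single (Poly_Mapping.single x n) 1"
  by (induction n) (auto simp: Var_def mult_single simp flip: single_add)

lemma single_monomial_Var:
  fixes m :: "'x::finite \<Rightarrow>\<^sub>0 nat"
  shows "Poly_Mapping.single m 1 = (\<Prod>x\<in>UNIV. Var x ^ Poly_Mapping.lookup m x :: ('x, 'k::field) mpoly)"
proof -
  have s: "Poly_Mapping.single (sum f A) (1::'k) = (\<Prod>x\<in>A. Poly_Mapping.single (f x) 1)"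
    for f :: "'x \<Rightarrow> 'x \<Rightarrow>\<^sub>0 nat" and A
  proof (induction A rule: infinite_finite_induct)
    case (insert x A)
    have "Poly_Mapping.single (f x + sum f A) (1::'k)
        = Poly_Mapping.single (f x) 1 * Poly_Mapping.single (sum f A) 1"
      by (simp add: mult_single)
    then show ?case using insert by simp
  qed auto
  have "m = (\<Sum>x\<in>UNIV. Poly_Mapping.single x (Poly_Mapping.lookup m x))"
    by (rule poly_mapping_eqI) (simp add: lookup_sum lookup_single when_def)
  then have "Poly_Mapping.single m (1::'k)
      = (\<Prod>x\<in>UNIV. Poly_Mapping.single (Poly_Mapping.single x (Poly_Mapping.lookup m x)) 1)"
    using s[of "\<lambda>x. Poly_Mapping.single x (Poly_Mapping.lookup m x)" UNIV] by simp
  then show ?thesis by (simp add: Var_power)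
qed

lemma monom_degree_add:
  fixes m m' :: "'x::finite \<Rightarrow>\<^sub>0 nat"
  shows "monom_degree (m + m') = monom_degree m + monom_degree m'"
proof -
  have "monom_degree n = (\<Sum>x\<in>UNIV. Poly_Mapping.lookup n x)" for n :: "'x \<Rightarrow>\<^sub>0 nat"
    unfolding monom_degree_def by (rule sum.mono_neutral_left) (auto simp: in_keys_iff)
  then show ?thesis by (simp add: lookup_add sum.distrib)
qed

lemma homogeneous_component_mult:
  fixes p q :: "('x::finite, 'k::field) mpoly"
  assumes "p \<in> homogeneous_component d" "q \<in> homogeneous_component e"
  shows "p * q \<in> homogeneous_component (d + e)"
  unfolding homogeneous_component_def
proof (intro CollectI ballI)
  fix m assume "m \<in> Poly_Mapping.keys (p * q)"
  then obtain u v where "m = u + v" "u \<in> Poly_Mapping.keys p" "v \<in> Poly_Mapping.keys q"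
    using Poly_Mapping.keys_mult[of p q] by auto
  then show "monom_degree m = d + e"
    using assms by (simp add: homogeneous_component_def monom_degree_add)
qed

lemma homogeneous_component_prod:
  fixes f :: "'a \<Rightarrow> ('x::finite, 'k::field) mpoly"
  assumes "finite A" "\<And>x. x \<in> A \<Longrightarrow> f x \<in> homogeneous_component 1"
  shows "prod f A \<in> homogeneous_component (card A)"
  using assms
proof (induction A rule: finite_induct)
  case empty
  then show ?case by (simp add: homogeneous_component_def monom_degree_def)
next
  case (insert x A)
  then show ?case using homogeneous_component_mult[of "f x" 1 "prod f A" "card A"] by simp
qed

text \<open>Over a finite field, one plus the product of all \<open>X - a\<close> has positive
  degree and takes the value 1 everywhere, so it has no root.\<close>

lemma infinite_UNIV_alg_closed: "infinite (UNIV :: 'k::alg_closed_field set)"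
proof
  assume fin: "finite (UNIV :: 'k set)"
  define p :: "'k poly" where "p = (\<Prod>a\<in>UNIV. [:- a, 1:]) + 1"
  have "degree (\<Prod>a\<in>(UNIV::'k set). [:- a, 1:]) = card (UNIV::'k set)"
    by (subst degree_prod_eq_sum_degree) auto
  moreover have "card (UNIV::'k set) > 0" using fin by (simp add: card_gt_0_iff)
  ultimately have "degree p > 0"
    unfolding p_def by (subst degree_add_eq_left) auto
  then obtain z where "poly p z = 0"
    using alg_closed_imp_poly_has_root by blast
  moreover have "poly (\<Prod>a\<in>(UNIV::'k set). [:- a, 1:]) z = 0"
    using fin by (simp add: poly_prod prod_zero_iff)
  ultimately show False by (simp add: p_def)
qed

text \<open>Rational curves are the only density argument used: a polynomial that vanishes on all but
  finitely many points of a curve vanishes on the whole curve.\<close>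

lemma eval_mpoly_curve:
  fixes \<gamma> :: "'x \<Rightarrow> 'k::alg_closed_field poly"
  assumes "finite B" "\<And>s. s \<notin> B \<Longrightarrow> eval_mpoly (\<lambda>x. poly (\<gamma> x) s) f = 0"
  shows "eval_mpoly (\<lambda>x. poly (\<gamma> x) s) f = 0"
proof -
  define q where "q = (\<Sum>m\<in>Poly_Mapping.keys f.
    [:Poly_Mapping.lookup f m:] * (\<Prod>x\<in>Poly_Mapping.keys m. \<gamma> x ^ Poly_Mapping.lookup m x))"
  have q: "poly q s = eval_mpoly (\<lambda>x. poly (\<gamma> x) s) f" for s
    by (simp add: q_def eval_mpoly_def poly_sum poly_prod)
  have "q = 0"
  proof (rule ccontr)
    assume "q \<noteq> 0"
    then have "finite {s. poly q s = 0}" by (rule poly_roots_finite)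
    moreover have "UNIV = B \<union> {s. poly q s = 0}" using assms(2) q by auto
    ultimately show False using infinite_UNIV_alg_closed assms(1) by (metis finite_UnI)
  qed
  then show ?thesis using q by (metis poly_0)
qed

text \<open>Otherwise the difference of two distinct monomials would be a nonzero polynomial with
  infinitely many roots. Only nonzero \<open>s\<close> is tested because the exponents are later
  read off at torus points.\<close>

lemma power_eq_all_imp_eq:
  assumes "\<And>s::'k::alg_closed_field. s \<noteq> 0 \<Longrightarrow> s ^ a = s ^ b"
  shows "a = b"
proof (rule ccontr)
  assume "a \<noteq> b"
  then have "monom (1::'k) a - monom 1 b \<noteq> 0" by (simp add: monom_eq_iff')
  then have "finite {s. poly (monom (1::'k) a - monom 1 b) s = 0}" by (rule poly_roots_finite)
  moreover have "UNIV - {0} \<subseteq> {s. poly (monom (1::'k) a - monom 1 b) s = 0}"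
    using assms by (auto simp: poly_monom)
  ultimately show False
    using infinite_UNIV_alg_closed by (metis finite_Diff2 finite.emptyI finite_insert finite_subset)
qed

text \<open>Dedekind's independence of characters, by induction on the number of characters.
  \<open>T\<close> need only be closed under \<open>mul\<close>, so the characters are total
  functions and must be told apart inside \<open>T\<close>.\<close>

lemma characters_independent:
  fixes mul :: "'t \<Rightarrow> 't \<Rightarrow> 't" and A :: "('t \<Rightarrow> 'k::field) set"
  assumes "finite A"
    and mul: "\<And>s t. s \<in> T \<Longrightarrow> t \<in> T \<Longrightarrow> mul s t \<in> T"
    and hom: "\<And>\<phi> s t. \<phi> \<in> A \<Longrightarrow> s \<in> T \<Longrightarrow> t \<in> T \<Longrightarrow> \<phi> (mul s t) = \<phi> s * \<phi> t"
    and nz: "\<And>\<phi>. \<phi> \<in> A \<Longrightarrow> \<exists>t\<in>T. \<phi> t \<noteq> 0"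
    and dist: "\<And>\<phi> \<psi>. \<phi> \<in> A \<Longrightarrow> \<psi> \<in> A \<Longrightarrow> \<phi> \<noteq> \<psi> \<Longrightarrow> \<exists>t\<in>T. \<phi> t \<noteq> \<psi> t"
    and zero: "\<And>t. t \<in> T \<Longrightarrow> (\<Sum>\<phi>\<in>A. d \<phi> * \<phi> t) = 0"
    and "\<phi> \<in> A"
  shows "d \<phi> = 0"
  using assms(1) hom nz dist zero \<open>\<phi> \<in> A\<close>
proof (induction A arbitrary: d \<phi> rule: finite_induct)
  case empty
  then show ?case by simp
next
  case (insert \<psi> A)
  have A: "d \<phi> = 0" if \<phi>: "\<phi> \<in> A" for \<phi>
  proof -
    \<comment> \<open>At a point \<open>s\<close> separating \<phi> from \<psi>, the relation at
      \<open>mul s t\<close> minus \<psi>\<open>s\<close> times the relation at \<open>t\<close>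
      loses its \<psi> term and is a shorter relation.\<close>
    obtain s where s: "s \<in> T" "\<phi> s \<noteq> \<psi> s" using insert.prems(3)[of \<phi> \<psi>] \<phi> insert.hyps by auto
    have "(\<Sum>\<phi>\<in>A. (d \<phi> * (\<phi> s - \<psi> s)) * \<phi> t) = 0" if t: "t \<in> T" for t
    proof -
      have 1: "d \<psi> * (\<psi> s * \<psi> t) + (\<Sum>\<phi>\<in>A. d \<phi> * (\<phi> s * \<phi> t)) = 0"
        using insert.prems(4)[OF mul[OF s(1) t]] insert.hyps insert.prems(1)[OF _ s(1) t]
        by simp
      have 2: "d \<psi> * \<psi> t + (\<Sum>\<phi>\<in>A. d \<phi> * \<phi> t) = 0"
        using insert.prems(4)[OF t] insert.hyps by simp
      have "(\<Sum>\<phi>\<in>A. (d \<phi> * (\<phi> s - \<psi> s)) * \<phi> t)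
          = (\<Sum>\<phi>\<in>A. d \<phi> * (\<phi> s * \<phi> t)) - \<psi> s * (\<Sum>\<phi>\<in>A. d \<phi> * \<phi> t)"
        by (simp add: algebra_simps sum_subtractf sum_distrib_left)
      also have "\<dots> = - (d \<psi> * (\<psi> s * \<psi> t)) + \<psi> s * (d \<psi> * \<psi> t)"
      proof -
        have "(\<Sum>\<phi>\<in>A. d \<phi> * (\<phi> s * \<phi> t)) = - (d \<psi> * (\<psi> s * \<psi> t))"
          using 1 by (simp add: eq_neg_iff_add_eq_0 add.commute)
        moreover have "(\<Sum>\<phi>\<in>A. d \<phi> * \<phi> t) = - (d \<psi> * \<psi> t)"
          using 2 by (simp add: eq_neg_iff_add_eq_0 add.commute)
        ultimately show ?thesis by (simp only:) simp
      qed
      finally show ?thesis by (simp add: mult_ac)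
    qed
    then have "d \<phi> * (\<phi> s - \<psi> s) = 0"
      using insert.IH[where d = "\<lambda>\<phi>. d \<phi> * (\<phi> s - \<psi> s)" and \<phi> = \<phi>] insert.prems \<phi> by auto
    then show ?thesis using s by simp
  qed
  have "d \<psi> = 0"
  proof -
    obtain t where t: "t \<in> T" "\<psi> t \<noteq> 0" using insert.prems(2)[of \<psi>] by auto
    have "(\<Sum>\<phi>\<in>A. d \<phi> * \<phi> t) = 0" using A by (intro sum.neutral) auto
    then show ?thesis using insert.prems(4)[OF t(1)] insert.hyps t(2) by simp
  qed
  then show ?case using A insert.prems(5) by auto
qed

text \<open>The subsets pair off as \<open>S\<close> and \<open>insert w S\<close>. This is the
  cancellation behind the inclusion-exclusion of the lower bound.\<close>

lemma sum_Pow_cancel: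
  fixes f :: "'a set \<Rightarrow> 'b::ab_group_add"
  assumes "finite A" "w \<in> A" "\<And>S. S \<subseteq> A - {w} \<Longrightarrow> f (insert w S) = - f S"
  shows "(\<Sum>S\<in>Pow A. f S) = 0"
proof -
  have "Pow A = Pow (A - {w}) \<union> insert w ` Pow (A - {w})"
    using Pow_insert[of w "A - {w}"] assms(2) by (simp add: insert_absorb)
  then have "(\<Sum>S\<in>Pow A. f S)
      = (\<Sum>S\<in>Pow (A - {w}). f S) + (\<Sum>S\<in>insert w ` Pow (A - {w}). f S)"
    using assms(1) by (simp only:) (rule sum.union_disjoint, auto)
  also have "(\<Sum>S\<in>insert w ` Pow (A - {w}). f S) = (\<Sum>S\<in>Pow (A - {w}). f (insert w S))"
    by (subst sum.reindex) (auto simp: inj_on_def)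
  also have "\<dots> = (\<Sum>S\<in>Pow (A - {w}). - f S)"
    using assms(3) by (intro sum.cong) auto
  finally show ?thesis by (simp add: sum_negf)
qed

section \<open>Paths and separation in forests\<close>

abbreviation adj :: "'n set set \<Rightarrow> 'n \<Rightarrow> 'n \<Rightarrow> bool" where
  "adj E i j \<equiv> {i, j} \<in> E"

definition simple_path :: "'n set set \<Rightarrow> 'n list \<Rightarrow> bool" where
  "simple_path E vs \<longleftrightarrow> vs \<noteq> [] \<and> distinct vs \<and> successively (adj E) vs"

lemma reachable_imp_simple_path:
  assumes "(adj E)\<^sup>*\<^sup>* i j"
  shows "\<exists>vs. simple_path E vs \<and> hd vs = i \<and> last vs = j"
  using assms
proof (induction rule: rtranclp_induct)
  case base
  show ?case by (rule exI[of _ "[i]"]) (simp add: simple_path_def)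
next
  case (step j k)
  then obtain vs where vs: "simple_path E vs" "hd vs = i" "last vs = j" by blast
  show ?case
  proof (cases "k \<in> set vs")
    \<comment> \<open>The walk returns to a vertex already on the path, so the path is cut off
      there.\<close>
    case True
    then obtain ys zs where "vs = ys @ k # zs" by (auto simp: in_set_conv_decomp)
    with vs show ?thesis
      by (intro exI[of _ "ys @ [k]"])
        (auto simp: simple_path_def successively_append_iff successively_Cons hd_append)
  next
    case False
    with vs step.hyps(2) show ?thesis
      by (intro exI[of _ "vs @ [k]"]) (auto simp: simple_path_def successively_append_iff)
  qed
qed

lemma simple_graph_edge_neq:
  assumes "simple_graph E" "{i, j} \<in> E"
  shows "i \<noteq> j"
  using assms by (force simp: simple_graph_def)

text \<open>A simple path from \<open>i\<close> to \<open>j\<close> that avoids the edge would close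
  up with it to a cycle.\<close>

lemma forest_edge_bridge:
  assumes "forest_graph E" "{i, j} \<in> E"
  shows "\<not> (adj (E - {{i, j}}))\<^sup>*\<^sup>* i j"
proof
  assume "(adj (E - {{i, j}}))\<^sup>*\<^sup>* i j"
  then obtain vs where vs: "simple_path (E - {{i, j}}) vs" "hd vs = i" "last vs = j"
    using reachable_imp_simple_path by metis
  have "i \<noteq> j" using assms simple_graph_edge_neq[of E i j] by (simp add: forest_graph_def)
  \<comment> \<open>A path with one vertex would give \<open>i = j\<close>, and one with two
    vertices would use the deleted edge.\<close>
  have "length vs \<ge> 3"
  proof (rule ccontr)
    assume "\<not> length vs \<ge> 3"
    then consider "vs = []" | a where "vs = [a]" | a b where "vs = [a, b]"
      by (cases vs; cases "tl vs"; cases "tl (tl vs)") auto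
    then show False using vs \<open>i \<noteq> j\<close> by cases (auto simp: simple_path_def)
  qed
  moreover have "{vs ! k, vs ! (Suc k mod length vs)} \<in> E" if k: "k < length vs" for k
  proof (cases "Suc k < length vs")
    case True
    then have "adj (E - {{i, j}}) (vs ! k) (vs ! Suc k)"
      using vs(1) unfolding simple_path_def by (auto dest: successively_nth)
    then show ?thesis using True by simp
  next
    case False
    then have [simp]: "Suc k = length vs" using k by simp
    then have "vs ! k = j" "vs ! 0 = i"
      using vs by (auto simp: last_conv_nth hd_conv_nth simple_path_def simp flip: \<open>Suc k = length vs\<close>)
    then show ?thesis using assms(2) by (simp add: insert_commute)
  qed
  ultimately have "graph_cycle E vs" using vs(1) by (auto simp: graph_cycle_def simple_path_def)
  then show False using assms(1) by (auto simp: forest_graph_def)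
qed

lemma forest_graph_subset: "forest_graph E \<Longrightarrow> E' \<subseteq> E \<Longrightarrow> forest_graph E'"
  unfolding forest_graph_def simple_graph_def graph_cycle_def by (meson subsetD)

lemma adj_rtranclp_sym: "(adj E)\<^sup>*\<^sup>* i j \<Longrightarrow> (adj E)\<^sup>*\<^sup>* j i"
  by (rule sympD[OF symp_rtranclp]) (simp_all add: symp_def insert_commute)

text \<open>Edges are added one at a time. If the ends of a new edge have equal colours, the colours
  are swapped on the old component of one end; the other end lies outside it because the new edge is
  a bridge.\<close>

lemma forest_two_colouring:
  fixes E :: "'n::finite set set"
  assumes "forest_graph E"
  shows "\<exists>c :: 'n \<Rightarrow> bool. \<forall>i j. {i, j} \<in> E \<longrightarrow> c i \<noteq> c j"
proof -
  have "finite E" by simp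
  then show ?thesis using assms
  proof (induction E rule: finite_induct)
    case empty
    then show ?case by simp
  next
    case (insert e E)
    have "forest_graph E" using insert.prems by (rule forest_graph_subset) auto
    then obtain c :: "'n \<Rightarrow> bool" where c: "\<And>i j. {i, j} \<in> E \<Longrightarrow> c i \<noteq> c j"
      using insert.IH by metis
    have "card e = 2" using insert.prems by (simp add: forest_graph_def simple_graph_def)
    then obtain i j where e: "e = {i, j}" "i \<noteq> j" by (auto simp: card_2_iff)
    show ?case
    proof (cases "c i = c j")
      case False
      then show ?thesis using c e by (intro exI[of _ c]) (auto simp: doubleton_eq_iff)
    next
      case True
      let ?R = "(adj E)\<^sup>*\<^sup>* i"
      have j: "\<not> ?R j"
      proof -
        have "insert e E - {{i, j}} = E" using insert.hyps e by auto
        then show ?thesis using forest_edge_bridge[OF insert.prems, of i j] e by simp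
      qed
      have R: "?R k \<longleftrightarrow> ?R l" if "{k, l} \<in> E" for k l
      proof -
        have "adj E k l" "adj E l k" using that by (simp_all add: insert_commute)
        then show ?thesis by (blast intro: rtranclp.rtrancl_into_rtrancl)
      qed
      have "c' k \<noteq> c' l"
        if "{k, l} \<in> insert e E" and [simp]: "c' = (\<lambda>k. if ?R k then \<not> c k else c k)" for c' k l
      proof (cases "{k, l} \<in> E")
        case True
        then show ?thesis using c R by simp
      next
        case False
        then have "(k = i \<and> l = j) \<or> (k = j \<and> l = i)"
          using that(1) e by (auto simp: doubleton_eq_iff)
        then show ?thesis using \<open>c i = c j\<close> j by auto
      qed
      then show ?thesis by blast
    qed
  qed
qed

lemma vertex_degree_ge_2:
  assumes "simple_graph E" "vertex_degree E w \<ge> 2"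
  obtains i j where "i \<noteq> j" "{w, i} \<in> E" "{w, j} \<in> E"
proof -
  obtain e1 where e1: "e1 \<in> {e \<in> E. w \<in> e}"
    using assms(2) unfolding vertex_degree_def by (metis card.empty equals0I not_numeral_le_zero)
  have "\<exists>e2. e2 \<in> {e \<in> E. w \<in> e} \<and> e2 \<noteq> e1"
  proof (rule ccontr)
    assume "\<not> ?thesis"
    then have "{e \<in> E. w \<in> e} \<subseteq> {e1}" by blast
    then have "card {e \<in> E. w \<in> e} \<le> 1" using card_mono[of "{e1}"] by fastforce
    then show False using assms(2) by (simp add: vertex_degree_def)
  qed
  then obtain e2 where e2: "e2 \<in> {e \<in> E. w \<in> e}" "e2 \<noteq> e1" by blast
  have "\<exists>i. e = {w, i}" if "e \<in> E" "w \<in> e" for e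
  proof -
    have "card e = 2" using assms(1) that by (simp add: simple_graph_def)
    then obtain a b where "e = {a, b}" by (auto simp: card_2_iff)
    then show ?thesis using that(2) by (auto simp: insert_commute)
  qed
  then obtain i j where ij: "e1 = {w, i}" "e2 = {w, j}" using e1 e2(1) by (metis mem_Collect_eq)
  show ?thesis
  proof (rule that)
    show "i \<noteq> j" using e2(2) ij by metis
    show "{w, i} \<in> E" "{w, j} \<in> E" using e1 e2(1) ij by (metis mem_Collect_eq)+
  qed
qed

lemma vertex_degree_ge_2I:
  fixes E :: "'n::finite set set"
  assumes "{a, b} \<in> E" "{b, c} \<in> E" "a \<noteq> c"
  shows "vertex_degree E b \<ge> 2"
proof -
  have "card {{a, b}, {b, c}} \<le> vertex_degree E b"
    unfolding vertex_degree_def by (rule card_mono) (use assms in auto)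
  moreover have "{a, b} \<noteq> {b, c}" using assms(3) by (auto simp: doubleton_eq_iff)
  ultimately show ?thesis by simp
qed

text \<open>\<open>C\<close> is the component of one neighbour \<open>i\<close> of \<open>w\<close>
  after all edges at \<open>w\<close> are deleted. If it contained a second neighbour
  \<open>j\<close>, going from \<open>i\<close> to \<open>j\<close> and then to \<open>w\<close>
  would bypass the bridge from \<open>i\<close> to \<open>w\<close>.\<close>

lemma forest_separation:
  assumes "forest_graph E" "vertex_degree E w \<ge> 2"
  obtains i j C where "{w, i} \<in> E" "{w, j} \<in> E" "i \<in> C" "j \<notin> C" "i \<noteq> w" "j \<noteq> w"
    "\<And>k l. {k, l} \<in> E \<Longrightarrow> k \<noteq> w \<Longrightarrow> l \<noteq> w \<Longrightarrow> k \<in> C \<longleftrightarrow> l \<in> C"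
proof -
  have s: "simple_graph E" using assms(1) by (simp add: forest_graph_def)
  obtain i j where ij: "i \<noteq> j" "{w, i} \<in> E" "{w, j} \<in> E"
    using vertex_degree_ge_2[OF s assms(2)] .
  define D where "D = {e \<in> E. w \<notin> e}"
  define C where "C = {k. (adj D)\<^sup>*\<^sup>* i k}"
  have "j \<notin> C"
  proof
    assume "j \<in> C"
    then have "(adj D)\<^sup>*\<^sup>* i j" by (simp add: C_def)
    then have "(adj (E - {{i, w}}))\<^sup>*\<^sup>* i j"
      by (rule rtranclp_mono[THEN predicate2D, rotated]) (auto simp: D_def)
    moreover have "adj (E - {{i, w}}) j w"
      using ij by (auto simp: doubleton_eq_iff insert_commute)
    ultimately have "(adj (E - {{i, w}}))\<^sup>*\<^sup>* i w" by (rule rtranclp.rtrancl_into_rtrancl)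
    then show False using forest_edge_bridge[OF assms(1), of i w] ij(2) by (simp add: insert_commute)
  qed
  moreover have "k \<in> C \<longleftrightarrow> l \<in> C" if "{k, l} \<in> E" "k \<noteq> w" "l \<noteq> w" for k l
  proof -
    have "adj D k l" "adj D l k" using that by (auto simp: D_def insert_commute)
    then show ?thesis unfolding C_def by (auto intro: rtranclp.rtrancl_into_rtrancl)
  qed
  moreover have "i \<in> C" by (simp add: C_def)
  moreover have "i \<noteq> w" "j \<noteq> w"
    using simple_graph_edge_neq[OF s ij(2)] simple_graph_edge_neq[OF s ij(3)] by auto
  ultimately show ?thesis by (intro that[OF ij(2,3)])
qed

lemma iv_eq: "iv E = {v. vertex_degree E v \<ge> 2}"
  by (auto simp: iv_def leaf_def isolated_vertex_def)

section \<open>Rotated coordinates\<close>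

text \<open>\<open>coord1\<close> and \<open>coord2\<close> record only which original variable is
  used; the sign of the rotation is carried by \<open>y2\<close> and \<open>point\<close>.\<close>

definition coord1 :: "('n \<Rightarrow> bool) \<Rightarrow> 'n \<Rightarrow> 'n \<times> 2" where
  "coord1 c i = (i, if c i then 2 else 1)"

definition coord2 :: "('n \<Rightarrow> bool) \<Rightarrow> 'n \<Rightarrow> 'n \<times> 2" where
  "coord2 c i = (i, if c i then 1 else 2)"

definition y1 :: "('n \<Rightarrow> bool) \<Rightarrow> 'n \<Rightarrow> ('n, 'k::field) lss_ring" where
  "y1 c i = Var (coord1 c i)"

definition y2 :: "('n \<Rightarrow> bool) \<Rightarrow> 'n \<Rightarrow> ('n, 'k::field) lss_ring" where
  "y2 c i = (if c i then - Var (coord2 c i) else Var (coord2 c i))"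

definition minor :: "('n \<Rightarrow> bool) \<Rightarrow> 'n \<Rightarrow> 'n \<Rightarrow> ('n, 'k::field) lss_ring" where
  "minor c i j = y1 c i * y2 c j - y2 c i * y1 c j"

text \<open>The inverse rotation: the values of the original variables at which \<open>y1\<close>
  and \<open>y2\<close> become \<open>p\<close> and \<open>q\<close>. The general coefficient ring
  also allows polynomial values, that is, curves.\<close>

definition point :: "('n \<Rightarrow> bool) \<Rightarrow> ('n \<Rightarrow> 'a::comm_ring_1) \<Rightarrow> ('n \<Rightarrow> 'a) \<Rightarrow> 'n \<times> 2 \<Rightarrow> 'a" where
  "point c p q x = (if x = coord1 c (fst x) then p (fst x)
     else if c (fst x) then - q (fst x) else q (fst x))"

text \<open>Zero vectors are allowed. For a proper colouring this describes the whole zero set of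
  the ideal, and \<open>U_set\<close> is its part without zero vectors.\<close>

definition parallel_along :: "'n set set \<Rightarrow> ('n \<Rightarrow> 'a::comm_ring_1) \<Rightarrow> ('n \<Rightarrow> 'a) \<Rightarrow> bool" where
  "parallel_along E p q \<longleftrightarrow> (\<forall>i j. {i, j} \<in> E \<longrightarrow> p i * q j = q i * p j)"

lemma point_simps [simp]:
  "point c p q (coord1 c i) = p i"
  "point c p q (coord2 c i) = (if c i then - q i else q i)"
  by (simp_all add: point_def coord1_def coord2_def)

lemma prod_coords:
  fixes f :: "'n::finite \<times> 2 \<Rightarrow> 'a::comm_monoid_mult"
  shows "(\<Prod>x\<in>UNIV. f x) = (\<Prod>i\<in>UNIV. f (coord1 c i) * f (coord2 c i))"
proof -
  have "(\<Prod>x\<in>UNIV. f x) = (\<Prod>i\<in>UNIV. \<Prod>k\<in>UNIV. f (i, k))"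
    by (simp add: prod.cartesian_product UNIV_Times_UNIV[symmetric] del: UNIV_Times_UNIV)
  also have "\<dots> = (\<Prod>i\<in>UNIV. f (coord1 c i) * f (coord2 c i))"
    by (intro prod.cong) (simp_all add: UNIV_2 coord1_def coord2_def mult.commute)
  finally show ?thesis .
qed

lemma eval_y [simp]:
  "eval_mpoly (point c p q) (y1 c i) = p i"
  "eval_mpoly (point c p q) (y2 c i) = q i"
  by (simp_all add: y1_def y2_def eval_mpoly_uminus)

lemma eval_minor:
  fixes p q :: "'n::finite \<Rightarrow> 'k::field"
  shows "eval_mpoly (point c p q) (minor c i j) = p i * q j - q i * p j"
  by (simp add: minor_def eval_mpoly_diff eval_mpoly_mult)

lemma poly_point: "poly (point c p q x) s = point c (\<lambda>i. poly (p i) s) (\<lambda>i. poly (q i) s) x"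
  by (simp add: point_def)

section \<open>The ideal and the prime in rotated coordinates\<close>

locale two_coloured =
  fixes E :: "'n::finite set set" and c :: "'n \<Rightarrow> bool"
  assumes colouring: "{i, j} \<in> E \<Longrightarrow> c i \<noteq> c j"
begin

text \<open>Exactly one end of an edge is rotated, which turns the dot product into a determinant up
  to sign.\<close>

lemma dot_point:
  assumes "{i, j} \<in> E" "parallel_along E p q"
  shows "point c p q (i, 1) * point c p q (j, 1) + point c p q (i, 2) * point c p q (j, 2) = 0"
proof -
  have "p i * q j = q i * p j" using assms by (auto simp: parallel_along_def)
  then show ?thesis
    using colouring[OF assms(1)] by (cases "c i"; cases "c j") (auto simp: point_def coord1_def mult.commute)
qed

lemma p_empty_iff:
  fixes g :: "('n, 'k::field) lss_ring"
  shows "g \<in> p_empty E \<longleftrightarrow>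
    (\<forall>p q. parallel_along E p q \<longrightarrow> (\<forall>i. p i \<noteq> 0 \<or> q i \<noteq> 0) \<longrightarrow> eval_mpoly (point c p q) g = 0)"
proof (intro iffI allI impI)
  fix p q :: "'n \<Rightarrow> 'k"
  assume g: "g \<in> p_empty E" and pq: "parallel_along E p q" "\<forall>i. p i \<noteq> 0 \<or> q i \<noteq> 0"
  define v :: "'k ^ 2 ^ 'n" where "v = (\<chi> i k. point c p q (i, k))"
  have v: "(\<lambda>(i, j). v $ i $ j) = point c p q" by (auto simp: v_def)
  have "v $ i \<noteq> 0" for i
    using pq(2)[rule_format, of i]
    by (auto simp: v_def vec_eq_iff forall_2 point_def coord1_def split: if_splits)
  moreover have "dot2 (v $ i) (v $ j) = 0" if "{i, j} \<in> E" for i j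
    using dot_point[OF that pq(1)] by (simp add: dot2_def v_def)
  ultimately have "v \<in> U_set E" by (simp add: U_set_def)
  then show "eval_mpoly (point c p q) g = 0" using g v by (auto simp: p_empty_def)
next
  assume *: "\<forall>p q. parallel_along E p q \<longrightarrow> (\<forall>i. p i \<noteq> 0 \<or> q i \<noteq> 0) \<longrightarrow> eval_mpoly (point c p q) g = 0"
  show "g \<in> p_empty E" unfolding p_empty_def
  proof (intro CollectI ballI)
    fix v :: "'k ^ 2 ^ 'n" assume v: "v \<in> U_set E"
    \<comment> \<open>The rotated coordinates of \<open>v\<close>: \<open>(x2, -x1)\<close> at the
      vertices with \<open>c i\<close>, and \<open>(x1, x2)\<close> at the others.\<close>
    define p where "p i = v $ i $ (if c i then 2 else 1)" for i
    define q where "q i = (if c i then - v $ i $ 1 else v $ i $ 2)" for i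
    have "(\<lambda>(i, j). v $ i $ j) = point c p q"
    proof
      fix x :: "'n \<times> 2"
      show "(\<lambda>(i, j). v $ i $ j) x = point c p q x"
        using exhaust_2[of "snd x"]
        by (cases x) (auto simp: point_def coord1_def p_def q_def)
    qed
    moreover have "parallel_along E p q"
      unfolding parallel_along_def
    proof (intro allI impI)
      fix i j assume e: "{i, j} \<in> E"
      then have "dot2 (v $ i) (v $ j) = 0" using v by (simp add: U_set_def)
      then show "p i * q j = q i * p j"
        using colouring[OF e]
        by (cases "c i"; cases "c j")
          (auto simp: dot2_def p_def q_def eq_neg_iff_add_eq_0 neg_eq_iff_add_eq_0 add.commute)
    qed
    moreover have "p i \<noteq> 0 \<or> q i \<noteq> 0" for i
      using v by (auto simp: U_set_def p_def q_def vec_eq_iff forall_2 split: if_splits)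
    ultimately show "eval_mpoly (\<lambda>(i, j). v $ i $ j) g = 0" using * by simp
  qed
qed

lemma LSS_ideal_vanishes:
  fixes g :: "('n, 'k::field) lss_ring"
  assumes "g \<in> LSS_ideal E" "parallel_along E p q"
  shows "eval_mpoly (point c p q) g = 0"
  using assms(1) unfolding LSS_ideal_def
proof (induction rule: ideal_generated_induct)
  case zero
  then show ?case by simp
next
  case (step r x y)
  then obtain i j where "{i, j} \<in> E" "x = Var (i, 1) * Var (j, 1) + Var (i, 2) * Var (j, 2)" by blast
  then show ?case using step dot_point[OF _ assms(2)] by (simp add: eval_mpoly_add eval_mpoly_mult)
qed

lemma minor_edge:
  assumes "{i, j} \<in> E"
  shows "(minor c i j :: ('n, 'k::field) lss_ring) \<in> LSS_ideal E"
proof -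
  let ?g = "Var (i, 1) * Var (j, 1) + Var (i, 2) * Var (j, 2) :: ('n, 'k) lss_ring"
  have g: "?g \<in> LSS_ideal E"
    unfolding LSS_ideal_def using assms by (intro ideal_generated_base) blast
  then have "- ?g \<in> LSS_ideal E" unfolding LSS_ideal_def by (rule ideal_generated_neg)
  moreover have "minor c i j = ?g \<or> minor c i j = - ?g"
    using colouring[OF assms]
    by (cases "c i"; cases "c j") (auto simp: minor_def y1_def y2_def coord1_def coord2_def algebra_simps)
  ultimately show ?thesis using g by metis
qed

end

section \<open>Monomials in rotated coordinates\<close>

definition ymonom :: "('n \<Rightarrow> bool) \<Rightarrow> ('n \<Rightarrow> nat) \<Rightarrow> ('n \<Rightarrow> nat) \<Rightarrow> ('n::finite, 'k::field) lss_ring" where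
  "ymonom c \<alpha> \<beta> = (\<Prod>i\<in>UNIV. y1 c i ^ \<alpha> i * y2 c i ^ \<beta> i)"

lemma eval_mpoly_power:
  fixes a :: "'x::finite \<Rightarrow> 'k::field"
  shows "eval_mpoly a (p ^ n) = eval_mpoly a p ^ n"
  by (induction n) (simp_all add: eval_mpoly_mult)

lemma eval_ymonom: "eval_mpoly (point c p q) (ymonom c \<alpha> \<beta>) = (\<Prod>i\<in>UNIV. p i ^ \<alpha> i * q i ^ \<beta> i)"
  by (simp add: ymonom_def eval_mpoly_prod eval_mpoly_mult eval_mpoly_power)

lemma const_mult: "Poly_Mapping.single 0 a * Poly_Mapping.single 0 b = (Poly_Mapping.single 0 (a * b) :: ('x, 'k::field) mpoly)"
  by (simp add: mult_single)

lemma const_power: "Poly_Mapping.single 0 a ^ n = (Poly_Mapping.single 0 (a ^ n) :: ('x, 'k::field) mpoly)"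
  by (induction n) (simp_all add: const_mult)

lemma const_prod:
  "(\<Prod>x\<in>A. Poly_Mapping.single 0 (f x)) = (Poly_Mapping.single 0 (prod f A) :: ('x, 'k::field) mpoly)"
  by (induction A rule: infinite_finite_induct) (simp_all add: const_mult)

text \<open>The constant \<open>e\<close> absorbs the coefficient and the signs from the rotated
  second coordinates.\<close>

lemma single_eq_ymonom:
  fixes k :: "'k::field"
  shows "\<exists>e. Poly_Mapping.single m k = Poly_Mapping.single 0 e *
    ymonom c (\<lambda>i. Poly_Mapping.lookup m (coord1 c i)) (\<lambda>i. Poly_Mapping.lookup m (coord2 c i))"
proof -
  define \<sigma> :: "'a \<Rightarrow> 'k" where "\<sigma> i = (if c i then -1 else 1)" for i
  have \<sigma>: "Var (coord2 c i) = Poly_Mapping.single 0 (\<sigma> i) * y2 c i" for i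
    by (simp add: \<sigma>_def y2_def single_uminus)
  let ?l = "Poly_Mapping.lookup m"
  have "Poly_Mapping.single m k = Poly_Mapping.single 0 k * Poly_Mapping.single m 1"
    by (simp add: mult_single)
  also have "Poly_Mapping.single m (1::'k)
      = (\<Prod>i\<in>UNIV. Var (coord1 c i) ^ ?l (coord1 c i) * Var (coord2 c i) ^ ?l (coord2 c i))"
    unfolding single_monomial_Var by (rule prod_coords)
  also have "\<dots> = (\<Prod>i\<in>UNIV. Poly_Mapping.single 0 (\<sigma> i ^ ?l (coord2 c i)) *
      (y1 c i ^ ?l (coord1 c i) * y2 c i ^ ?l (coord2 c i)))"
    by (simp add: \<sigma> power_mult_distrib const_power y1_def[symmetric] mult_ac)
  also have "\<dots> = Poly_Mapping.single 0 (\<Prod>i\<in>UNIV. \<sigma> i ^ ?l (coord2 c i)) *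
      ymonom c (\<lambda>i. ?l (coord1 c i)) (\<lambda>i. ?l (coord2 c i))"
    by (simp add: prod.distrib const_prod ymonom_def)
  finally show ?thesis
    by (auto simp: mult.assoc[symmetric] const_mult)
qed

lemma ymonom_upd1: "ymonom c (\<alpha>(i := Suc (\<alpha> i))) \<beta> = y1 c i * ymonom c \<alpha> \<beta>"
proof -
  have "ymonom c (\<alpha>(i := Suc (\<alpha> i))) \<beta>
    = (\<Prod>k\<in>UNIV. (if k = i then y1 c i else 1) * (y1 c k ^ \<alpha> k * y2 c k ^ \<beta> k))"
    unfolding ymonom_def by (rule prod.cong) (auto simp: mult_ac)
  then show ?thesis by (simp add: prod.distrib ymonom_def)
qed

lemma ymonom_upd2: "ymonom c \<alpha> (\<beta>(i := Suc (\<beta> i))) = y2 c i * ymonom c \<alpha> \<beta>"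
proof -
  have "ymonom c \<alpha> (\<beta>(i := Suc (\<beta> i)))
    = (\<Prod>k\<in>UNIV. (if k = i then y2 c i else 1) * (y1 c k ^ \<alpha> k * y2 c k ^ \<beta> k))"
    unfolding ymonom_def by (rule prod.cong) (auto simp: mult_ac)
  then show ?thesis by (simp add: prod.distrib ymonom_def)
qed

section \<open>Upper bound\<close>

text \<open>The expansion of the determinant with rows \<open>y1\<close>, \<open>y1\<close>,
  \<open>y2\<close> on the columns \<open>a\<close>, \<open>b\<close>, \<open>d\<close>, which
  vanishes because a row is repeated. It routes the minor of \<open>a\<close> and \<open>d\<close>
  through \<open>b\<close> at the price of a factor \<open>y1 c b\<close>.\<close>

lemma minor_exchange: "y1 c b * minor c a d = y1 c a * minor c b d + y1 c d * minor c a b"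
  by (simp add: minor_def algebra_simps)

lemma simple_path_Cons:
  "simple_path E (a # b # vs) \<longleftrightarrow> {a, b} \<in> E \<and> a \<notin> set (b # vs) \<and> simple_path E (b # vs)"
  by (auto simp: simple_path_def)

text \<open>\<open>butlast (tl vs)\<close> lists the inner vertices, and each has two distinct
  neighbours on the path.\<close>

lemma simple_path_inner_degree:
  fixes E :: "'n::finite set set"
  assumes "simple_path E vs" "w \<in> set (butlast (tl vs))"
  shows "vertex_degree E w \<ge> 2"
  using assms
proof (induction vs)
  case Nil
  then show ?case by simp
next
  case (Cons a us)
  show ?case
  proof (cases us)
    case Nil
    then show ?thesis using Cons.prems by simp
  next
    case us: (Cons b ws)
    show ?thesis
    proof (cases ws)
      case Nil
      then show ?thesis using Cons.prems us by simp
    next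
      case ws: (Cons d zs)
      have "vertex_degree E b \<ge> 2"
        using Cons.prems(1) us ws by (intro vertex_degree_ge_2I[of a b E d]) (auto simp: simple_path_Cons)
      moreover have "w = b \<or> w \<in> set (butlast (tl us))" using Cons.prems(2) us ws by auto
      moreover have "simple_path E us" using Cons.prems(1) us by (simp add: simple_path_Cons)
      ultimately show ?thesis using Cons.IH by blast
    qed
  qed
qed

definition interior_prod :: "('n \<Rightarrow> bool) \<Rightarrow> 'n::finite set set \<Rightarrow> ('n, 'k::field) lss_ring" where
  "interior_prod c E = (\<Prod>w\<in>iv E. y1 c w)"

lemma interior_prod_homogeneous: "interior_prod c E \<in> homogeneous_component (card (iv E))"
proof -
  have "y1 c w \<in> homogeneous_component 1" for w
    by (simp add: y1_def Var_def homogeneous_component_def monom_degree_def)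
  then show ?thesis unfolding interior_prod_def by (intro homogeneous_component_prod) auto
qed

lemma eval_interior_prod: "eval_mpoly (point c p q) (interior_prod c E) = (\<Prod>w\<in>iv E. p w)"
  by (simp add: interior_prod_def eval_mpoly_prod)

lemma prod_if_power:
  fixes s :: "'k::field" and \<alpha> :: "'n::finite \<Rightarrow> nat"
  shows "(\<Prod>k\<in>UNIV. (if P k then s else 1) ^ \<alpha> k) = s ^ (\<Sum>k | P k. \<alpha> k)"
proof -
  have "(\<Prod>k\<in>UNIV. (if P k then s else 1) ^ \<alpha> k) = (\<Prod>k | P k. s ^ \<alpha> k)"
    by (rule prod.mono_neutral_cong_right) auto
  then show ?thesis by (simp add: power_sum)
qed

context two_coloured
begin

lemma LSS_closed:
  fixes a b :: "('n, 'k::field) lss_ring"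
  shows "0 \<in> (LSS_ideal E :: ('n, 'k) lss_ring set)"
    "a \<in> LSS_ideal E \<Longrightarrow> b \<in> LSS_ideal E \<Longrightarrow> a + b \<in> LSS_ideal E"
    "a \<in> LSS_ideal E \<Longrightarrow> r * a \<in> LSS_ideal E"
  unfolding LSS_ideal_def
  by (simp_all add: ideal_generated_zero ideal_generated_add ideal_generated_mult)

text \<open>Induction along the path: exchanging at the second vertex \<open>b\<close> splits the
  long minor into the minor of an edge and the minor of the shorter path. With a single vertex the
  minor is zero.\<close>

lemma path_minor:
  assumes "simple_path E vs"
  shows "(\<Prod>w\<in>set (butlast (tl vs)). y1 c w) * minor c (hd vs) (last vs)
    \<in> (LSS_ideal E :: ('n, 'k::field) lss_ring set)"
  using assms
proof (induction vs)
  case Nil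
  then show ?case by (simp add: simple_path_def)
next
  case (Cons a us)
  show ?case
  proof (cases us)
    case Nil
    then show ?thesis by (simp add: minor_def LSS_closed mult.commute)
  next
    case us: (Cons b ws)
    have ab: "{a, b} \<in> E" and path: "simple_path E us"
      using Cons.prems us by (simp_all add: simple_path_Cons)
    show ?thesis
    proof (cases ws)
      case Nil
      then show ?thesis using us minor_edge[OF ab] by simp
    next
      case ws: (Cons d zs)
      let ?Q = "\<Prod>w\<in>set (butlast ws). y1 c w :: ('n, 'k) lss_ring"
      let ?z = "last us"
      have IH: "?Q * minor c b ?z \<in> LSS_ideal E" using Cons.IH[OF path] us by simp
      have "b \<notin> set (butlast ws)"
        using path us by (auto simp: simple_path_def dest: in_set_butlastD)
      then have "(\<Prod>w\<in>set (butlast (tl (a # us))). y1 c w) * minor c (hd (a # us)) (last (a # us))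
          = ?Q * (y1 c b * minor c a ?z)"
        using us ws by (simp add: mult_ac)
      also have "\<dots> = y1 c a * (?Q * minor c b ?z) + (?Q * y1 c ?z) * minor c a b"
        by (subst minor_exchange) (simp add: algebra_simps)
      also have "\<dots> \<in> LSS_ideal E"
        by (rule LSS_closed(2)[OF LSS_closed(3)[OF IH] LSS_closed(3)[OF minor_edge[OF ab]]])
      finally show ?thesis .
    qed
  qed
qed

text \<open>The inner vertices of a path lie in \<open>iv E\<close>; the other factors of the
  product are mere multipliers.\<close>

lemma interior_prod_minor:
  assumes "(adj E)\<^sup>*\<^sup>* i j"
  shows "interior_prod c E * minor c i j \<in> (LSS_ideal E :: ('n, 'k::field) lss_ring set)"
proof -
  obtain vs where vs: "simple_path E vs" "hd vs = i" "last vs = j"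
    using reachable_imp_simple_path[OF assms] by blast
  let ?A = "set (butlast (tl vs))"
  have "?A \<subseteq> iv E" using simple_path_inner_degree[OF vs(1)] by (auto simp: iv_eq)
  then have "(interior_prod c E :: ('n, 'k) lss_ring) = (\<Prod>w\<in>iv E - ?A. y1 c w) * (\<Prod>w\<in>?A. y1 c w)"
    unfolding interior_prod_def by (intro prod.subset_diff) auto
  then have "(interior_prod c E * minor c i j :: ('n, 'k) lss_ring)
      = (\<Prod>w\<in>iv E - ?A. y1 c w) * ((\<Prod>w\<in>?A. y1 c w) * minor c i j)"
    by (simp add: mult_ac)
  then show ?thesis using LSS_closed(3)[OF path_minor[OF vs(1), unfolded vs]] by (simp only:)
qed

text \<open>A first coordinate is moved from a vertex \<open>i\<close> with a surplus to a vertex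
  \<open>j\<close> of its component with a deficit, while a second coordinate moves back. Each move
  changes \<open>F\<close> times the monomial by a multiple of
  \<open>F * minor c i j\<close>.\<close>

lemma ymonom_congruent:
  fixes F :: "('n, 'k::field) lss_ring"
  assumes F: "\<And>i j. (adj E)\<^sup>*\<^sup>* i j \<Longrightarrow> F * minor c i j \<in> LSS_ideal E"
    and "\<And>i. \<alpha> i + \<beta> i = \<alpha>' i + \<beta>' i"
    and "\<And>i. (\<Sum>j | (adj E)\<^sup>*\<^sup>* i j. \<alpha> j) = (\<Sum>j | (adj E)\<^sup>*\<^sup>* i j. \<alpha>' j)"
  shows "F * ymonom c \<alpha> \<beta> - F * ymonom c \<alpha>' \<beta>' \<in> LSS_ideal E"
  using assms(2,3)
\<comment> \<open>Subtraction of naturals truncates, so the measure counts only the total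
  surplus.\<close>
proof (induction "\<Sum>i\<in>UNIV. \<alpha> i - \<alpha>' i" arbitrary: \<alpha> \<beta> rule: less_induct)
  case less
  let ?R = "(adj E)\<^sup>*\<^sup>*"
  show ?case
  proof (cases "\<exists>i. \<alpha> i > \<alpha>' i")
    case False
    then have le: "\<alpha> i \<le> \<alpha>' i" for i by (simp add: not_less)
    have "\<alpha> i = \<alpha>' i" for i
    proof (rule ccontr)
      assume "\<alpha> i \<noteq> \<alpha>' i"
      then have "\<alpha> i < \<alpha>' i" using le[of i] by simp
      then have "(\<Sum>j | ?R i j. \<alpha> j) < (\<Sum>j | ?R i j. \<alpha>' j)"
        by (intro sum_strict_mono_ex1) (auto simp: le)
      then show False using less.prems(2)[of i] by simp
    qed
    moreover from this have "\<beta> i = \<beta>' i" for i using less.prems(1)[of i] by simp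
    ultimately have "\<alpha> = \<alpha>'" "\<beta> = \<beta>'" by auto
    then show ?thesis by (simp add: LSS_closed)
  next
    case True
    then obtain i where i: "\<alpha> i > \<alpha>' i" by blast
    have "\<exists>j. ?R i j \<and> \<alpha> j < \<alpha>' j"
    proof (rule ccontr)
      assume "\<not> ?thesis"
      then have "(\<Sum>j | ?R i j. \<alpha>' j) < (\<Sum>j | ?R i j. \<alpha> j)"
        using i by (intro sum_strict_mono_ex1) (auto simp: not_less)
      then show False using less.prems(2)[of i] by simp
    qed
    then obtain j where j: "?R i j" "\<alpha> j < \<alpha>' j" by blast
    have "i \<noteq> j" using i j by auto
    have \<beta>j: "\<beta> j > 0" using less.prems(1)[of j] j(2) by linarith
    \<comment> \<open>\<alpha>\<open>0\<close>, \<beta>\<open>0\<close> are the exponents of the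
      common factor left after one \<open>y1 c i\<close> and one \<open>y2 c j\<close> are removed;
      \<alpha>\<open>1\<close>, \<beta>\<open>1\<close> result from multiplying it by
      \<open>y1 c j\<close> and \<open>y2 c i\<close>.\<close>
    define \<alpha>0 where "\<alpha>0 = \<alpha>(i := \<alpha> i - 1)"
    define \<beta>0 where "\<beta>0 = \<beta>(j := \<beta> j - 1)"
    define \<alpha>1 where "\<alpha>1 = \<alpha>0(j := Suc (\<alpha>0 j))"
    define \<beta>1 where "\<beta>1 = \<beta>0(i := Suc (\<beta>0 i))"
    have \<alpha>: "\<alpha> = \<alpha>0(i := Suc (\<alpha>0 i))" using i by (auto simp: \<alpha>0_def)
    have \<beta>: "\<beta> = \<beta>0(j := Suc (\<beta>0 j))" using \<beta>j by (auto simp: \<beta>0_def)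
    \<comment> \<open>Writing the move additively on both sides avoids truncated subtraction in the
      component sums.\<close>
    have \<alpha>1: "\<alpha>1 k + of_bool (k = i) = \<alpha> k + of_bool (k = j)" for k
      using i \<open>i \<noteq> j\<close> by (auto simp: \<alpha>1_def \<alpha>0_def)
    have "F * ymonom c \<alpha>1 \<beta>1 - F * ymonom c \<alpha>' \<beta>' \<in> LSS_ideal E"
    proof (rule less.hyps)
      show "(\<Sum>i\<in>UNIV. \<alpha>1 i - \<alpha>' i) < (\<Sum>i\<in>UNIV. \<alpha> i - \<alpha>' i)"
      proof (rule sum_strict_mono_ex1)
        show "\<forall>k\<in>UNIV. \<alpha>1 k - \<alpha>' k \<le> \<alpha> k - \<alpha>' k"
          using j(2) by (auto simp: \<alpha>1_def \<alpha>0_def)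
        show "\<exists>k\<in>UNIV. \<alpha>1 k - \<alpha>' k < \<alpha> k - \<alpha>' k"
          using i \<open>i \<noteq> j\<close> by (intro bexI[of _ i]) (auto simp: \<alpha>1_def \<alpha>0_def)
      qed simp
      show "\<alpha>1 k + \<beta>1 k = \<alpha>' k + \<beta>' k" for k
        using less.prems(1)[of k] i \<beta>j \<open>i \<noteq> j\<close> by (auto simp: \<alpha>1_def \<beta>1_def \<alpha>0_def \<beta>0_def)
      show "(\<Sum>j | ?R k j. \<alpha>1 j) = (\<Sum>j | ?R k j. \<alpha>' j)" for k
      proof -
        have "?R k i \<longleftrightarrow> ?R k j"
          using j(1) adj_rtranclp_sym[OF j(1)] by (meson rtranclp_trans)
        moreover have "(\<Sum>l | ?R k l. \<alpha>1 l + of_bool (l = i)) = (\<Sum>l | ?R k l. \<alpha> l + of_bool (l = j))"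
          using \<alpha>1 by (intro sum.cong) auto
        ultimately show ?thesis using less.prems(2)[of k]
          by (simp add: sum.distrib of_bool_def)
      qed
    qed
    moreover have "F * ymonom c \<alpha> \<beta> - F * ymonom c \<alpha>1 \<beta>1 = ymonom c \<alpha>0 \<beta>0 * (F * minor c i j)"
    proof -
      have "ymonom c \<alpha> \<beta> = y1 c i * (y2 c j * (ymonom c \<alpha>0 \<beta>0 :: ('n, 'k) lss_ring))"
        by (subst \<alpha>, subst \<beta>) (simp only: ymonom_upd1 ymonom_upd2 mult.left_commute)
      moreover have "ymonom c \<alpha>1 \<beta>1 = y1 c j * (y2 c i * (ymonom c \<alpha>0 \<beta>0 :: ('n, 'k) lss_ring))"
        by (simp only: \<alpha>1_def \<beta>1_def ymonom_upd1 ymonom_upd2 mult.left_commute)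
      ultimately show ?thesis by (simp add: minor_def algebra_simps)
    qed
    ultimately have "(F * ymonom c \<alpha> \<beta> - F * ymonom c \<alpha>1 \<beta>1)
        + (F * ymonom c \<alpha>1 \<beta>1 - F * ymonom c \<alpha>' \<beta>') \<in> LSS_ideal E"
      by (simp only:) (intro LSS_closed F j(1))
    then show ?thesis by simp
  qed
qed

text \<open>The hard inclusion for the colon ideal. The monomials of \<open>g\<close> are grouped by
  the characters they induce on the torus points; within a class they are congruent after
  multiplication by \<open>F\<close>, and the coefficients of a class add up to zero.\<close>

lemma interior_prod_p_empty:
  fixes g :: "('n, 'k::alg_closed_field) lss_ring"
  assumes "g \<in> p_empty E"
  shows "interior_prod c E * g \<in> LSS_ideal E"
proof -
  let ?R = "(adj E)\<^sup>*\<^sup>*" and ?F = "interior_prod c E :: ('n, 'k) lss_ring"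
  let ?K = "Poly_Mapping.keys g"
  define \<alpha> where "\<alpha> m i = Poly_Mapping.lookup m (coord1 c i)" for m :: "'n \<times> 2 \<Rightarrow>\<^sub>0 nat" and i
  define \<beta> where "\<beta> m i = Poly_Mapping.lookup m (coord2 c i)" for m :: "'n \<times> 2 \<Rightarrow>\<^sub>0 nat" and i
  have "\<exists>e. \<forall>m. Poly_Mapping.single m (Poly_Mapping.lookup g m)
      = Poly_Mapping.single 0 (e m) * ymonom c (\<alpha> m) (\<beta> m)"
    unfolding \<alpha>_def \<beta>_def using single_eq_ymonom by (intro choice) auto
  then obtain e where e: "\<And>m. Poly_Mapping.single m (Poly_Mapping.lookup g m)
      = Poly_Mapping.single 0 (e m) * ymonom c (\<alpha> m) (\<beta> m)" by blast
  have g: "g = (\<Sum>m\<in>?K. Poly_Mapping.single 0 (e m) * ymonom c (\<alpha> m) (\<beta> m))"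
    by (rule trans[OF mpoly_sum_single]) (simp only: e)
  \<comment> \<open>The torus points of \<open>U\<close>, closed under coordinatewise
    multiplication.\<close>
  define T :: "(('n \<Rightarrow> 'k) \<times> ('n \<Rightarrow> 'k)) set" where
    "T = {(p, q). parallel_along E p q \<and> (\<forall>i. p i \<noteq> 0 \<and> q i \<noteq> 0)}"
  define mul :: "('n \<Rightarrow> 'k) \<times> ('n \<Rightarrow> 'k) \<Rightarrow> _ \<Rightarrow> _" where
    "mul s t = ((\<lambda>i. fst s i * fst t i), (\<lambda>i. snd s i * snd t i))" for s t
  \<comment> \<open>The value 0 outside \<open>T\<close> makes characters that agree on
    \<open>T\<close> equal as functions.\<close>
  define ch where "ch m t = (if t \<in> T then (\<Prod>i\<in>UNIV. fst t i ^ \<alpha> m i * snd t i ^ \<beta> m i) else 0)" for m t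
  have vanish: "(\<Sum>m\<in>?K. e m * ch m t) = 0" if t: "t \<in> T" for t
  proof -
    obtain p q where pq: "t = (p, q)" by (cases t)
    have "eval_mpoly (point c p q) g = 0"
      using assms t pq by (auto simp: p_empty_iff T_def)
    moreover have "eval_mpoly (point c p q) g = (\<Sum>m\<in>?K. e m * ch m t)"
      by (subst g) (use t in \<open>simp add: eval_mpoly_sum eval_mpoly_mult eval_mpoly_single
        monom_eval_def eval_ymonom ch_def pq\<close>)
    ultimately show ?thesis by simp
  qed
  have class_sum: "(\<Sum>m | m \<in> ?K \<and> ch m = \<phi>. e m) = 0" if "\<phi> \<in> ch ` ?K" for \<phi>
  proof (rule characters_independent[where A = "ch ` ?K" and T = T and mul = mul
        and d = "\<lambda>\<phi>. \<Sum>m | m \<in> ?K \<and> ch m = \<phi>. e m"])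
    show mul: "mul s t \<in> T" if "s \<in> T" "t \<in> T" for s t
      using that by (auto simp: T_def mul_def parallel_along_def) (metis mult.assoc mult.commute)
    show "\<phi> (mul s t) = \<phi> s * \<phi> t" if "\<phi> \<in> ch ` ?K" "s \<in> T" "t \<in> T" for \<phi> s t
      using that mul[of s t]
      by (auto simp: ch_def) (simp add: mul_def power_mult_distrib mult_ac prod.distrib)
    show "\<exists>t\<in>T. \<phi> t \<noteq> 0" if "\<phi> \<in> ch ` ?K" for \<phi>
      using that by (intro bexI[of _ "(\<lambda>_. 1, \<lambda>_. 1)"]) (auto simp: ch_def T_def parallel_along_def)
    show "\<exists>t\<in>T. \<phi> t \<noteq> \<psi> t" if "\<phi> \<in> ch ` ?K" "\<psi> \<in> ch ` ?K" "\<phi> \<noteq> \<psi>" for \<phi> \<psi>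
    proof (rule ccontr)
      assume "\<not> ?thesis"
      then have "\<phi> t = \<psi> t" for t using that(1,2) by (cases "t \<in> T") (auto simp: ch_def)
      then show False using that(3) by auto
    qed
    show "(\<Sum>\<phi>\<in>ch ` ?K. (\<Sum>m | m \<in> ?K \<and> ch m = \<phi>. e m) * \<phi> t) = 0" if "t \<in> T" for t
    proof -
      have "(\<Sum>m\<in>?K. e m * ch m t) = (\<Sum>\<phi>\<in>ch ` ?K. \<Sum>m | m \<in> ?K \<and> ch m = \<phi>. e m * ch m t)"
        by (rule sum.image_gen) simp
      also have "\<dots> = (\<Sum>\<phi>\<in>ch ` ?K. (\<Sum>m | m \<in> ?K \<and> ch m = \<phi>. e m) * \<phi> t)"
        by (intro sum.cong) (auto simp: sum_distrib_right)
      finally show ?thesis using vanish[OF that] by simp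
    qed
  qed (use that in auto)
  have congruent: "?F * ymonom c (\<alpha> m) (\<beta> m) - ?F * ymonom c (\<alpha> m') (\<beta> m') \<in> LSS_ideal E"
    if ch: "ch m = ch m'" for m m'
  proof (rule ymonom_congruent)
    show "?F * minor c i j \<in> LSS_ideal E" if "?R i j" for i j
      using that by (rule interior_prod_minor)
    show "\<alpha> m i + \<beta> m i = \<alpha> m' i + \<beta> m' i" for i
    proof (rule power_eq_all_imp_eq)
      fix s :: 'k assume "s \<noteq> 0"
      \<comment> \<open>Scaling the whole vector at \<open>i\<close> keeps it parallel to its
        neighbours and reads off the degree at \<open>i\<close>.\<close>
      let ?p = "\<lambda>k. if k = i then s else 1"
      have t: "(?p, ?p) \<in> T" using \<open>s \<noteq> 0\<close> by (auto simp: T_def parallel_along_def)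
      have "ch m (?p, ?p) = s ^ (\<alpha> m i + \<beta> m i)" for m
        using t prod_if_power[of "\<lambda>k. k = i" s "\<lambda>k. \<alpha> m k + \<beta> m k"]
        by (simp add: ch_def power_add)
      then show "s ^ (\<alpha> m i + \<beta> m i) = s ^ (\<alpha> m' i + \<beta> m' i)" using ch by metis
    qed
    show "(\<Sum>j | ?R i j. \<alpha> m j) = (\<Sum>j | ?R i j. \<alpha> m' j)" for i
    proof (rule power_eq_all_imp_eq)
      fix s :: 'k assume "s \<noteq> 0"
      \<comment> \<open>Scaling the first coordinates throughout one component respects all edges
        and reads off the number of first coordinates there.\<close>
      let ?p = "\<lambda>k. if ?R i k then s else 1"
      have "?R i k \<longleftrightarrow> ?R i l" if "{k, l} \<in> E" for k l
      proof -
        have "adj E k l" "adj E l k" using that by (simp_all add: insert_commute)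
        then show ?thesis by (blast intro: rtranclp.rtrancl_into_rtrancl)
      qed
      then have t: "(?p, \<lambda>_. 1) \<in> T" using \<open>s \<noteq> 0\<close> by (auto simp: T_def parallel_along_def)
      have "ch m (?p, \<lambda>_. 1) = s ^ (\<Sum>j | ?R i j. \<alpha> m j)" for m
        using t prod_if_power[of "?R i" s "\<alpha> m"] by (simp add: ch_def)
      then show "s ^ (\<Sum>j | ?R i j. \<alpha> m j) = s ^ (\<Sum>j | ?R i j. \<alpha> m' j)" using ch by metis
    qed
  qed
  let ?Y = "\<lambda>m. ?F * ymonom c (\<alpha> m) (\<beta> m)"
  have "?F * g = (\<Sum>m\<in>?K. Poly_Mapping.single 0 (e m) * ?Y m)"
    by (subst g) (simp add: sum_distrib_left mult_ac)
  also have "\<dots> = (\<Sum>\<phi>\<in>ch ` ?K. \<Sum>m | m \<in> ?K \<and> ch m = \<phi>. Poly_Mapping.single 0 (e m) * ?Y m)"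
    by (rule sum.image_gen) simp
  also have "\<dots> \<in> LSS_ideal E"
    unfolding LSS_ideal_def
  proof (rule ideal_generated_sum, fold LSS_ideal_def)
    fix \<phi> assume \<phi>: "\<phi> \<in> ch ` ?K"
    then obtain m0 where m0: "\<phi> = ch m0" by blast
    let ?C = "{m \<in> ?K. ch m = \<phi>}"
    \<comment> \<open>Since the coefficients of the class sum to zero, the representative
      \<open>?Y m0\<close> can be subtracted from every term.\<close>
    have "(\<Sum>m\<in>?C. Poly_Mapping.single 0 (e m)) * ?Y m0 = 0"
    proof -
      have "Poly_Mapping.single 0 (sum e ?C) = (\<Sum>m\<in>?C. Poly_Mapping.single (0::'n \<times> 2 \<Rightarrow>\<^sub>0 nat) (e m))"
        by (rule poly_mapping_eqI) (simp add: lookup_sum lookup_single when_def)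
      then show ?thesis using class_sum[OF \<phi>] by (metis mult_zero_left single_zero)
    qed
    then have "(\<Sum>m\<in>?C. Poly_Mapping.single 0 (e m) * ?Y m)
        = (\<Sum>m\<in>?C. Poly_Mapping.single 0 (e m) * (?Y m - ?Y m0))"
      by (simp add: right_diff_distrib sum_subtractf sum_distrib_right)
    also have "\<dots> \<in> LSS_ideal E"
      unfolding LSS_ideal_def
    proof (rule ideal_generated_sum, fold LSS_ideal_def)
      fix m assume "m \<in> ?C"
      then show "Poly_Mapping.single 0 (e m) * (?Y m - ?Y m0) \<in> LSS_ideal E"
        using congruent[of m m0] m0 by (intro LSS_closed(3)) auto
    qed
    finally show "(\<Sum>m\<in>?C. Poly_Mapping.single 0 (e m) * ?Y m) \<in> LSS_ideal E" .
  qed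
  finally show ?thesis .
qed

end

section \<open>Lower bound\<close>

text \<open>Two vectors parallel to the same nonzero vector \<open>(u, v)\<close> are parallel to
  each other.\<close>

lemma parallel_trans:
  fixes a b u v x y :: "'k::field"
  assumes "u * b = v * a" "u * y = v * x" "u \<noteq> 0 \<or> v \<noteq> 0"
  shows "a * y = b * x"
proof -
  have "u * (a * y) = u * (b * x)" "v * (a * y) = v * (b * x)"
    using assms(1,2) by (metis mult.assoc mult.left_commute)+
  then show ?thesis using assms(3) by auto
qed

context two_coloured
begin

text \<open>For the remaining inclusion, \<open>g\<close> vanishes wherever the product of first
  coordinates does not. Every other point of \<open>U\<close> is reached along a curve of such
  points.\<close>

lemma colon_interior_prod:
  "ideal_colon (LSS_ideal E) (interior_prod c E) = (p_empty E :: ('n, 'k::alg_closed_field) lss_ring set)"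
proof (intro equalityI subsetI)
  fix g :: "('n, 'k) lss_ring" assume "g \<in> p_empty E"
  then show "g \<in> ideal_colon (LSS_ideal E) (interior_prod c E)"
    using interior_prod_p_empty[of g] by (simp add: ideal_colon_def mult.commute)
next
  fix g :: "('n, 'k) lss_ring"
  assume "g \<in> ideal_colon (LSS_ideal E) (interior_prod c E)"
  then have g: "g * interior_prod c E \<in> LSS_ideal E" by (simp add: ideal_colon_def)
  show "g \<in> p_empty E" unfolding p_empty_iff
  proof (intro allI impI)
    fix p q :: "'n \<Rightarrow> 'k"
    assume pq: "parallel_along E p q" "\<forall>i. p i \<noteq> 0 \<or> q i \<noteq> 0"
    \<comment> \<open>A shear preserves parallelism. As no vector is zero, all first coordinates
      \<open>p i + s * q i\<close> are nonzero for all but finitely many \<open>s\<close>, and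
      \<open>s = 0\<close> is the given point.\<close>
    define \<gamma> where "\<gamma> = point c (\<lambda>i. [:p i, q i:]) (\<lambda>i. [:q i:])"
    have \<gamma>: "(\<lambda>x. poly (\<gamma> x) s) = point c (\<lambda>i. p i + s * q i) q" for s
      by (simp add: \<gamma>_def poly_point fun_eq_iff)
    have "eval_mpoly (\<lambda>x. poly (\<gamma> x) 0) g = 0"
    proof (rule eval_mpoly_curve)
      have "finite {s. p i + s * q i = 0}" for i
      proof -
        have "[:p i, q i:] \<noteq> 0" using pq(2) by auto
        then show ?thesis using poly_roots_finite[of "[:p i, q i:]"] by simp
      qed
      then show "finite (\<Union>i. {s. p i + s * q i = 0})" by simp
    next
      fix s assume s: "s \<notin> (\<Union>i. {s. p i + s * q i = 0})"
      have "parallel_along E (\<lambda>i. p i + s * q i) q"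
        using pq(1) by (auto simp: parallel_along_def algebra_simps)
      then have "eval_mpoly (point c (\<lambda>i. p i + s * q i) q) (g * interior_prod c E) = 0"
        by (rule LSS_ideal_vanishes[OF g])
      then show "eval_mpoly (\<lambda>x. poly (\<gamma> x) s) g = 0"
        using s by (simp add: \<gamma> eval_mpoly_mult eval_interior_prod prod_zero_iff)
    qed
    then show "eval_mpoly (point c p q) g = 0" by (simp add: \<gamma>)
  qed
qed

text \<open>Zeroing \<open>w\<close> decouples the two sides \<open>C\<close> and its complement of the forest without \<open>w\<close>.
  Shearing the vectors in \<open>C\<close> makes the minor of a neighbour in \<open>C\<close> and a neighbour
  outside nonzero, while the edge equations persist; that minor lies in \<open>p_empty E\<close>, so the other
  factor \<open>f\<close> vanishes on the curve.\<close>

lemma vanishes_on_zeroed: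
  fixes f :: "('n, 'k::alg_closed_field) lss_ring"
  assumes forest: "forest_graph E"
    and f: "\<And>g. g \<in> p_empty E \<Longrightarrow> g * f \<in> LSS_ideal E"
    and w: "vertex_degree E w \<ge> 2" "w \<in> S"
    and pq: "parallel_along E p q" "\<And>i. p i \<noteq> 0 \<or> q i \<noteq> 0"
  shows "eval_mpoly (point c (\<lambda>k. if k \<in> S then 0 else p k) (\<lambda>k. if k \<in> S then 0 else q k)) f = 0"
proof -
  obtain i j C where ij: "{w, i} \<in> E" "{w, j} \<in> E" "i \<in> C" "j \<notin> C" "i \<noteq> w" "j \<noteq> w"
    and C: "\<And>k l. {k, l} \<in> E \<Longrightarrow> k \<noteq> w \<Longrightarrow> l \<noteq> w \<Longrightarrow> k \<in> C \<longleftrightarrow> l \<in> C"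
    using forest_separation[OF forest w(1)] by blast
  have par: "p' i * q' j = q' i * p' j"
    if "parallel_along E p' q'" "\<And>i. p' i \<noteq> 0 \<or> q' i \<noteq> 0" for p' q' :: "'n \<Rightarrow> 'k"
    using that ij(1,2) parallel_trans[of "p' w" "q' i" "q' w" "p' i" "q' j" "p' j"]
    by (auto simp: parallel_along_def)
  have "(minor c i j :: ('n, 'k) lss_ring) \<in> p_empty E"
    unfolding p_empty_iff using par by (auto simp: eval_minor)
  then have minor: "minor c i j * f \<in> LSS_ideal E" by (rule f)
  \<comment> \<open>The shear direction is linear in the vector at \<open>k\<close> and chosen
    uniformly by whether \<open>p i\<close> vanishes. As the vectors at \<open>i\<close> and
    \<open>j\<close> are parallel and nonzero, it makes their minor nonzero.\<close>
  define n1 where "n1 k = (if p i \<noteq> 0 then 0 else q k)" for k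
  define n2 where "n2 k = (if p i \<noteq> 0 then p k else 0)" for k
  have n: "n1 i * q j - n2 i * p j \<noteq> 0"
    using par[OF pq] pq(2)[of i] pq(2)[of j] by (auto simp: n1_def n2_def)
  \<comment> \<open>The vector at \<open>w\<close> is zero along the whole curve, while the other
    vectors of \<open>S\<close> are scaled by \<open>s\<close> and reach zero only at
    \<open>s = 0\<close>.\<close>
  define \<tau> :: "'n \<Rightarrow> 'k poly" where "\<tau> k = (if k = w then 0 else if k \<in> S then [:0, 1:] else 1)" for k
  define P where "P k = \<tau> k * [:p k, if k \<in> C then n1 k else 0:]" for k
  define Q where "Q k = \<tau> k * [:q k, if k \<in> C then n2 k else 0:]" for k
  define \<gamma> where "\<gamma> = point c P Q"
  have \<gamma>: "(\<lambda>x. poly (\<gamma> x) s) = point c (\<lambda>i. poly (P i) s) (\<lambda>i. poly (Q i) s)" for s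
    by (simp add: \<gamma>_def poly_point fun_eq_iff)
  have "eval_mpoly (\<lambda>x. poly (\<gamma> x) 0) f = 0"
  proof (rule eval_mpoly_curve)
    fix s :: 'k assume "s \<notin> {0}"
    have "parallel_along E (\<lambda>i. poly (P i) s) (\<lambda>i. poly (Q i) s)"
      unfolding parallel_along_def
    proof (intro allI impI)
      fix k l assume e: "{k, l} \<in> E"
      then have kl: "p k * q l = q k * p l" using pq(1) by (auto simp: parallel_along_def)
      show "poly (P k) s * poly (Q l) s = poly (Q k) s * poly (P l) s"
      proof (cases "k = w \<or> l = w")
        case True
        then show ?thesis by (auto simp: P_def Q_def \<tau>_def)
      next
        case False
        have "(p k + s * n1 k) * (q l + s * n2 l) = (q k + s * n2 k) * (p l + s * n1 l)"
          using kl by (auto simp: n1_def n2_def algebra_simps)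
        moreover have "k \<in> C \<longleftrightarrow> l \<in> C" using C[OF e] False by auto
        ultimately have "(p k + s * (if k \<in> C then n1 k else 0)) * (q l + s * (if l \<in> C then n2 l else 0))
            = (q k + s * (if k \<in> C then n2 k else 0)) * (p l + s * (if l \<in> C then n1 l else 0))"
          using kl by (cases "k \<in> C") simp_all
        from arg_cong[OF this, of "\<lambda>a. poly (\<tau> k) s * (poly (\<tau> l) s * a)"] show ?thesis
          unfolding P_def Q_def poly_mult poly_pCons poly_0 mult_zero_right add_0_right
          by (simp only: mult_ac)
      qed
    qed
    then have "eval_mpoly (point c (\<lambda>i. poly (P i) s) (\<lambda>i. poly (Q i) s)) (minor c i j * f) = 0"
      by (rule LSS_ideal_vanishes[OF minor])
    then have "(poly (P i) s * poly (Q j) s - poly (Q i) s * poly (P j) s) * eval_mpoly (\<lambda>x. poly (\<gamma> x) s) f = 0"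
      by (simp add: eval_mpoly_mult eval_minor \<gamma>)
    \<comment> \<open>The constant term is the minor of the original point, which is zero, so a
      nonzero multiple of \<open>s\<close> remains.\<close>
    moreover have "poly (P i) s * poly (Q j) s - poly (Q i) s * poly (P j) s
        = poly (\<tau> i) s * poly (\<tau> j) s * (s * (n1 i * q j - n2 i * p j))"
    proof -
      have "poly (P i) s * poly (Q j) s - poly (Q i) s * poly (P j) s
        = poly (\<tau> i) s * poly (\<tau> j) s * ((p i * q j - q i * p j) + s * (n1 i * q j - n2 i * p j))"
        using ij(3,4) by (simp add: P_def Q_def algebra_simps)
      then show ?thesis using par[OF pq] by simp
    qed
    moreover have "poly (\<tau> i) s \<noteq> 0" "poly (\<tau> j) s \<noteq> 0"
      using \<open>s \<notin> {0}\<close> ij(5,6) by (auto simp: \<tau>_def)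
    ultimately show "eval_mpoly (\<lambda>x. poly (\<gamma> x) s) f = 0" using n \<open>s \<notin> {0}\<close> by auto
  qed simp
  moreover have "poly (P k) 0 = (if k \<in> S then 0 else p k)" "poly (Q k) 0 = (if k \<in> S then 0 else q k)" for k
    using w(2) by (auto simp: P_def Q_def \<tau>_def)
  ultimately show ?thesis by (simp add: \<gamma>)
qed

text \<open>An alternating sum of values of \<open>f\<close> over zeroed subsets of
  \<open>iv E\<close> is computed twice. Only the empty subset contributes a nonzero value, but if
  the degree were too small the sum would cancel for each monomial.\<close>

lemma colon_degree_ge:
  fixes f :: "('n, 'k::alg_closed_field) lss_ring"
  assumes forest: "forest_graph E"
    and hom: "f \<in> homogeneous_component e"
    and colon: "ideal_colon (LSS_ideal E) f = p_empty E"
  shows "card (iv E) \<le> e"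
proof (rule ccontr)
  assume "\<not> card (iv E) \<le> e"
  \<comment> \<open>Otherwise the product of first coordinates would lie in \<open>I : f\<close>,
    hence in the prime, although it equals 1 at the all-ones point.\<close>
  have "f \<notin> p_empty E"
  proof
    assume "f \<in> p_empty E"
    then have "interior_prod c E \<in> (p_empty E :: ('n, 'k) lss_ring set)"
      using interior_prod_p_empty[of f] colon by (auto simp: ideal_colon_def)
    then have "eval_mpoly (point c (\<lambda>_. 1) (\<lambda>_. 1)) (interior_prod c E) = (0::'k)"
      by (simp add: p_empty_iff parallel_along_def)
    then show False by (simp add: eval_interior_prod)
  qed
  then obtain p q where pq: "parallel_along E p q" "\<And>i. p i \<noteq> 0 \<or> q i \<noteq> 0"
    and nz: "eval_mpoly (point c p q) f \<noteq> 0"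
    by (auto simp: p_empty_iff)
  define z where "z S = point c (\<lambda>k. if k \<in> S then 0 else p k) (\<lambda>k. if k \<in> S then 0 else q k)" for S
  have zeroed: "eval_mpoly (z S) f = 0" if S: "S \<in> Pow (iv E)" "S \<noteq> {}" for S
  proof -
    obtain w where "w \<in> S" using S(2) by blast
    moreover from this have "vertex_degree E w \<ge> 2" using S(1) by (auto simp: iv_eq)
    moreover have "g * f \<in> LSS_ideal E" if "g \<in> p_empty E" for g
      using that colon by (auto simp: ideal_colon_def)
    ultimately show ?thesis unfolding z_def using vanishes_on_zeroed[OF forest] pq by blast
  qed
  have "(\<Sum>S\<in>Pow (iv E). (-1) ^ card S * eval_mpoly (z S) f) = eval_mpoly (z {}) f"
  proof -
    have "(\<Sum>S\<in>Pow (iv E). (-1) ^ card S * eval_mpoly (z S) f)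
        = (\<Sum>S\<in>{{}}. (-1) ^ card S * eval_mpoly (z S) f)"
      by (rule sum.mono_neutral_right) (use zeroed in auto)
    then show ?thesis by simp
  qed
  moreover have "(\<Sum>S\<in>Pow (iv E). (-1) ^ card S * eval_mpoly (z S) f) = 0"
  proof -
    have "(\<Sum>S\<in>Pow (iv E). (-1) ^ card S * eval_mpoly (z S) f) =
        (\<Sum>m\<in>Poly_Mapping.keys f. \<Sum>S\<in>Pow (iv E).
          (-1) ^ card S * (Poly_Mapping.lookup f m * monom_eval (z S) m))"
      unfolding eval_mpoly_alt sum_distrib_left by (rule sum.swap)
    also have "\<dots> = 0"
    proof (rule sum.neutral, rule ballI)
      fix m assume "m \<in> Poly_Mapping.keys f"
      then have "monom_degree m = e" using hom by (simp add: homogeneous_component_def)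
      \<comment> \<open>A monomial of degree \<open>e\<close> involves at most \<open>e\<close>
        vertices, fewer than \<open>card (iv E)\<close>.\<close>
      have "\<exists>w\<in>iv E. w \<notin> fst ` Poly_Mapping.keys m"
      proof (rule ccontr)
        assume "\<not> ?thesis"
        then have "card (iv E) \<le> card (fst ` Poly_Mapping.keys m)" by (intro card_mono) auto
        also have "\<dots> \<le> card (Poly_Mapping.keys m)" by (rule card_image_le) simp
        also have "\<dots> \<le> monom_degree m"
          unfolding monom_degree_def card_eq_sum by (rule sum_mono) (simp add: in_keys_iff Suc_le_eq)
        finally show False using \<open>\<not> card (iv E) \<le> e\<close> \<open>monom_degree m = e\<close> by simp
      qed
      then obtain w where w: "w \<in> iv E" "w \<notin> fst ` Poly_Mapping.keys m" by blast
      show "(\<Sum>S\<in>Pow (iv E). (-1) ^ card S * (Poly_Mapping.lookup f m * monom_eval (z S) m)) = 0"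
      proof (rule sum_Pow_cancel[OF _ w(1)])
        fix S assume "S \<subseteq> iv E - {w}"
        then have "card (insert w S) = Suc (card S)"
          by (subst card_insert_disjoint) auto
        \<comment> \<open>Zeroing \<open>w\<close> does not affect a monomial without variables at
          \<open>w\<close>; only the sign changes.\<close>
        moreover have "monom_eval (z (insert w S)) m = monom_eval (z S) m"
          unfolding monom_eval_def
        proof (rule prod.cong[OF refl])
          fix x assume "x \<in> Poly_Mapping.keys m"
          then have "fst x \<noteq> w" using w(2) by auto
          then show "z (insert w S) x ^ Poly_Mapping.lookup m x = z S x ^ Poly_Mapping.lookup m x"
            by (simp add: z_def point_def)
        qed
        ultimately show "(-1) ^ card (insert w S) * (Poly_Mapping.lookup f m * monom_eval (z (insert w S)) m)
            = - ((-1) ^ card S * (Poly_Mapping.lookup f m * monom_eval (z S) m))" by simp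
      qed simp
    qed
    finally show ?thesis .
  qed
  ultimately show False using nz by (simp add: z_def)
qed

end

lemma Inf_enat_image_eqI:
  assumes "n \<in> A" "\<And>e. e \<in> A \<Longrightarrow> n \<le> e"
  shows "Inf (enat ` A) = enat n"
  using assms by (intro antisym Inf_lower Inf_greatest) auto

theorem proposition4p10:
  fixes E :: "'n::finite set set"
  assumes "forest_graph E"
  shows "v_number (p_empty E :: ('n, 'k::alg_closed_field) lss_ring set) (LSS_ideal E) = enat (v2 E)
       \<and> v2 E = card (iv E)"
proof
  show v2: "v2 E = card (iv E)" by (simp add: v2_def iv_eq)
  obtain c :: "'n \<Rightarrow> bool" where "\<forall>i j. {i, j} \<in> E \<longrightarrow> c i \<noteq> c j" using forest_two_colouring[OF assms] by blast
  then interpret two_coloured E c by unfold_locales auto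
  let ?D = "{e. \<exists>f\<in>homogeneous_component e. ideal_colon (LSS_ideal E) f
    = (p_empty E :: ('n, 'k) lss_ring set)}"
  have "card (iv E) \<in> ?D" using interior_prod_homogeneous colon_interior_prod by blast
  moreover have "card (iv E) \<le> e" if "e \<in> ?D" for e using that colon_degree_ge[OF assms] by blast
  ultimately have "Inf (enat ` ?D) = enat (card (iv E))" by (rule Inf_enat_image_eqI)
  then show "v_number (p_empty E :: ('n, 'k) lss_ring set) (LSS_ideal E) = enat (v2 E)"
    by (simp only: v_number_def v2)
qed

end
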